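(* Let $X$ be a Banach space having property $M(1,s)$ for some $0<s\leq 1$. If there exists a point $x_0\in S_X$ at which the relative weak and norm topologies of $S_X$ agree, then $X$ has the generalized Gossez-Lami Dozo (GGLD) property.
   Context: $S_X$ denotes the unit sphere $\{x\in X:\|x\|=1\}$ of the Banach space $X$. Property $M(r,s)$: given $r,s\in(0,1]$, $X$ has property $M(r,s)$ if whenever $u,v\in X$ satisfy $\|u\|\leq\|v\|$ and $(x_\alpha)$ is a bounded weakly null net in $X$, then $\limsup_\alpha\|ru+sx_\alpha\|\leq\limsup_\alpha\|v+x_\alpha\|$. The relative weak and norm topologies of $S_X$ agree at $x_0\in S_X$ if the identity map from $S_X$ with the relative weak topology to $S_X$ with the norm topology is continuous at $x_0$. GGLD property: $X$ has the GGLD property if for every weakly null sequence $(x_n)$ in $X$ such that $\lim_n\|x_n\|=1$ we have $D[(x_n)]>1$, where $D[(x_n)]=\limsup_n\left(\limsup_m\|x_n-x_m\|\right)$. *)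

theory Defs
  imports "HOL-Analysis.Analysis"
begin

text \<open>Real scalars lose no generality: a complex Banach space has the same weak topology as its
  underlying real space, and all notions below use only that topology, the norm and real scalars.\<close>

definition weak_topology :: "'a::real_normed_vector topology" where
  "weak_topology =
     topology_generated_by {blinfun_apply f -` U | (f :: 'a \<Rightarrow>\<^sub>L real) U. open U}"

definition directed_set :: "'i set \<Rightarrow> ('i \<Rightarrow> 'i \<Rightarrow> bool) \<Rightarrow> bool" where
  "directed_set I le \<longleftrightarrow>
     I \<noteq> {} \<and>
     (\<forall>i\<in>I. le i i) \<and>
     (\<forall>i\<in>I. \<forall>j\<in>I. \<forall>k\<in>I. le i j \<longrightarrow> le j k \<longrightarrow> le i k) \<and>
     (\<forall>i\<in>I. \<forall>j\<in>I. \<exists>k\<in>I. le i k \<and> le j k)"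

text \<open>The filter of tails of a directed set; limits and limits superior of nets are taken along it.\<close>

definition net_filter :: "'i set \<Rightarrow> ('i \<Rightarrow> 'i \<Rightarrow> bool) \<Rightarrow> 'i filter" where
  "net_filter I le = (INF i\<in>I. principal {j \<in> I. le i j})"

text \<open>Only \<open>x\<close> restricted to \<open>I\<close> matters.\<close>

definition bounded_weakly_null_net ::
    "'i set \<Rightarrow> ('i \<Rightarrow> 'i \<Rightarrow> bool) \<Rightarrow> ('i \<Rightarrow> 'a::real_normed_vector) \<Rightarrow> bool" where
  "bounded_weakly_null_net I le x \<longleftrightarrow>
     directed_set I le \<and> bounded (x ` I) \<and> limitin weak_topology x 0 (net_filter I le)"

text \<open>HOL cannot quantify over the type of the indices inside a definition, so the nets are indexed
  by directed subsets of \<^typ>\<open>'a \<times> 'a set\<close>. This is no restriction: by \<open>property_M_any_net\<close> below,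
  the inequality then holds for nets over any index type. The limits superior are taken in
  \<^typ>\<open>ereal\<close>; they are finite because the nets are bounded.\<close>

definition property_M :: "'a::real_normed_vector itself \<Rightarrow> real \<Rightarrow> real \<Rightarrow> bool" where
  "property_M TYPE('a) r s \<longleftrightarrow>
     (\<forall>(u::'a) (v::'a) (I :: ('a \<times> 'a set) set) le x.
        norm u \<le> norm v \<longrightarrow> bounded_weakly_null_net I le x \<longrightarrow>
        Limsup (net_filter I le) (\<lambda>i. ereal (norm (r *\<^sub>R u + s *\<^sub>R x i)))
          \<le> Limsup (net_filter I le) (\<lambda>i. ereal (norm (v + x i))))"

definition weak_norm_agree_at :: "'a::real_normed_vector \<Rightarrow> bool" where
  "weak_norm_agree_at x0 \<longleftrightarrow>
     topcontinuous_at (subtopology weak_topology (sphere 0 1)) (top_of_set (sphere 0 1)) id x0"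

definition asymptotic_sep :: "(nat \<Rightarrow> 'a::real_normed_vector) \<Rightarrow> ereal" where
  "asymptotic_sep x = limsup (\<lambda>n. limsup (\<lambda>m. ereal (norm (x n - x m))))"

definition GGLD :: "'a::real_normed_vector itself \<Rightarrow> bool" where
  "GGLD TYPE('a) \<longleftrightarrow>
     (\<forall>x :: nat \<Rightarrow> 'a. limitin weak_topology x 0 sequentially \<longrightarrow>
        (\<lambda>n. norm (x n)) \<longlonglongrightarrow> 1 \<longrightarrow> asymptotic_sep x > 1)"

lemma topspace_weak_topology [simp]: "topspace weak_topology = UNIV"
proof -
  have "blinfun_apply (0 :: 'a \<Rightarrow>\<^sub>L real) -` UNIV = UNIV" by simp
  then show ?thesis
    unfolding weak_topology_def topology_generated_by_topspace by blast
qed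

lemma limitin_weak_topology:
  fixes x :: "'i \<Rightarrow> 'a::real_normed_vector"
  shows "limitin weak_topology x l F \<longleftrightarrow>
    (\<forall>f :: 'a \<Rightarrow>\<^sub>L real. ((\<lambda>i. blinfun_apply f (x i)) \<longlongrightarrow> blinfun_apply f l) F)"
proof
  assume L: "limitin weak_topology x l F"
  show "\<forall>f :: 'a \<Rightarrow>\<^sub>L real. ((\<lambda>i. f (x i)) \<longlongrightarrow> f l) F"
  proof (intro allI topological_tendstoI)
    fix f :: "'a \<Rightarrow>\<^sub>L real" and U assume U: "open U" "f l \<in> U"
    have "openin weak_topology (blinfun_apply f -` U)"
      unfolding weak_topology_def by (rule topology_generated_by_Basis) (use U in blast)
    with L U have "\<forall>\<^sub>F i in F. x i \<in> blinfun_apply f -` U"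
      unfolding limitin_def by (metis vimageI)
    then show "\<forall>\<^sub>F i in F. f (x i) \<in> U" by simp
  qed
next
  assume R: "\<forall>f :: 'a \<Rightarrow>\<^sub>L real. ((\<lambda>i. f (x i)) \<longlongrightarrow> f l) F"
  have "\<forall>\<^sub>F i in F. x i \<in> V" if "openin weak_topology V" "l \<in> V" for V
  proof -
    have "generate_topology_on {blinfun_apply f -` U | (f :: 'a \<Rightarrow>\<^sub>L real) U. open U} V"
      using that(1) by (simp add: weak_topology_def openin_topology_generated_by_iff)
    then show ?thesis using that(2)
    proof (induction rule: generate_topology_on.induct)
      case (Int a b) then show ?case by (simp add: eventually_conj_iff)
    next
      case (UN K)
      then obtain k where k: "k \<in> K" "l \<in> k" by blast
      with UN have "\<forall>\<^sub>F i in F. x i \<in> k" by blast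
      then show ?case by eventually_elim (use k in blast)
    next
      case (Basis B)
      then obtain f :: "'a \<Rightarrow>\<^sub>L real" and U where "B = f -` U" "open U" by blast
      moreover from this Basis have "f l \<in> U" by simp
      ultimately have "\<forall>\<^sub>F i in F. f (x i) \<in> U" using R topological_tendstoD by blast
      then show ?case by (simp add: \<open>B = f -` U\<close>)
    qed simp
  qed
  then show "limitin weak_topology x l F" by (simp add: limitin_def)
qed

lemma eventually_net_filter:
  assumes "directed_set I le"
  shows "eventually P (net_filter I le) \<longleftrightarrow> (\<exists>i\<in>I. \<forall>j\<in>I. le i j \<longrightarrow> P j)"
proof -
  have "eventually P (net_filter I le) \<longleftrightarrow>
      (\<exists>i\<in>I. eventually P (principal {j \<in> I. le i j}))"
    unfolding net_filter_def
  proof (rule eventually_INF_base)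
    show "I \<noteq> {}" using assms by (simp add: directed_set_def)
    fix i j assume ij: "i \<in> I" "j \<in> I"
    then obtain k where k: "k \<in> I" "le i k" "le j k"
      using assms unfolding directed_set_def by meson
    have "{m \<in> I. le k m} \<subseteq> {m \<in> I. le i m} \<inter> {m \<in> I. le j m}"
      using assms ij k unfolding directed_set_def by blast
    with k show "\<exists>k\<in>I. principal {m \<in> I. le k m}
        \<le> inf (principal {m \<in> I. le i m}) (principal {m \<in> I. le j m})"
      by auto
  qed
  then show ?thesis by (auto simp: eventually_principal)
qed

lemma Limsup_filtermap_image:
  "Limsup (filtermap f F) g = Limsup F (\<lambda>x. g (f x) :: 'b::complete_lattice)"
proof (rule antisym)
  show "Limsup (filtermap f F) g \<le> Limsup F (\<lambda>x. g (f x))"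
    unfolding Limsup_def
  proof (rule INF_mono)
    fix P assume "P \<in> {P. eventually P F}"
    then have "eventually (\<lambda>x. f x \<in> f ` Collect P) F"
      by (auto elim: eventually_mono)
    then have "(\<lambda>y. y \<in> f ` Collect P) \<in> {P. eventually P (filtermap f F)}"
      by (simp add: eventually_filtermap)
    moreover have "Sup (g ` Collect (\<lambda>y. y \<in> f ` Collect P)) \<le> Sup ((\<lambda>x. g (f x)) ` Collect P)"
      by (simp add: image_image)
    ultimately show "\<exists>Q\<in>{P. eventually P (filtermap f F)}.
        Sup (g ` Collect Q) \<le> Sup ((\<lambda>x. g (f x)) ` Collect P)"
      by blast
  qed
qed (rule Limsup_filtermap_ge)

lemma property_M_any_net:
  fixes x :: "'i \<Rightarrow> 'a::real_normed_vector"
  assumes M: "property_M TYPE('a) r s"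
    and uv: "norm u \<le> norm v"
    and x: "bounded_weakly_null_net I le x"
  shows "Limsup (net_filter I le) (\<lambda>i. ereal (norm (r *\<^sub>R u + s *\<^sub>R x i)))
       \<le> Limsup (net_filter I le) (\<lambda>i. ereal (norm (v + x i)))"
proof -
  define F where "F = filtermap x (net_filter I le)"
  define J where "J = {(y, A). y \<in> A \<and> A \<subseteq> x ` I \<and> eventually (\<lambda>z. z \<in> A) F}"
  define ge :: "'a \<times> 'a set \<Rightarrow> 'a \<times> 'a set \<Rightarrow> bool" where "ge = (\<lambda>p q. snd q \<subseteq> snd p)"
  have dI: "directed_set I le" and bd: "bounded (x ` I)"
    and lim: "limitin weak_topology x 0 (net_filter I le)"
    using x by (auto simp: bounded_weakly_null_net_def)
  have evI: "eventually (\<lambda>z. z \<in> x ` I) F"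
  proof -
    obtain i where "i \<in> I" using dI unfolding directed_set_def by blast
    then show ?thesis
      unfolding F_def eventually_filtermap eventually_net_filter[OF dI, of "\<lambda>i. x i \<in> x ` I"] by blast
  qed
  have ne: "A \<noteq> {}" if ev: "eventually (\<lambda>z. z \<in> A) F" for A
  proof -
    obtain i where i: "i \<in> I" "\<forall>j\<in>I. le i j \<longrightarrow> x j \<in> A"
      using ev unfolding F_def eventually_filtermap eventually_net_filter[OF dI] by blast
    moreover have "le i i" using dI i(1) unfolding directed_set_def by blast
    ultimately show ?thesis by blast
  qed
  have dJ: "directed_set J ge"
    unfolding directed_set_def
  proof (intro conjI ballI)
    obtain y where "y \<in> x ` I" using ne[OF evI] by blast
    then have "(y, x ` I) \<in> J" using evI by (auto simp: J_def)
    then show "J \<noteq> {}" by blast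
  next
    fix p q assume "p \<in> J" "q \<in> J"
    moreover obtain a A b B where pq: "p = (a, A)" "q = (b, B)" by (metis surj_pair)
    ultimately have AB: "eventually (\<lambda>z. z \<in> A \<inter> B) F" "A \<inter> B \<subseteq> x ` I"
      by (auto simp: J_def eventually_conj_iff)
    then obtain c where "c \<in> A \<inter> B" using ne by blast
    with AB have "(c, A \<inter> B) \<in> J" by (auto simp: J_def)
    then show "\<exists>k\<in>J. ge p k \<and> ge q k" by (rule bexI[rotated]) (auto simp: ge_def pq)
  qed (auto simp: ge_def)
  have F_eq: "filtermap fst (net_filter J ge) = F"
  proof (rule filter_eq_iff[THEN iffD2], intro allI iffI)
    fix P assume "eventually P (filtermap fst (net_filter J ge))"
    then obtain a A where A: "(a, A) \<in> J" "\<And>q. q \<in> J \<Longrightarrow> ge (a, A) q \<Longrightarrow> P (fst q)"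
      by (auto simp: eventually_filtermap eventually_net_filter[OF dJ])
    have "P z" if "z \<in> A" for z
      using A(2)[of "(z, A)"] A(1) that by (auto simp: J_def ge_def)
    then show "eventually P F" using A(1) by (auto simp: J_def elim: eventually_mono)
  next
    fix P assume "eventually P F"
    with evI have ev: "eventually (\<lambda>z. z \<in> {z \<in> x ` I. P z}) F"
      by (simp add: eventually_conj_iff)
    then obtain y where "y \<in> {z \<in> x ` I. P z}" using ne by blast
    with ev have "(y, {z \<in> x ` I. P z}) \<in> J" by (auto simp: J_def)
    moreover have "P (fst q)" if "q \<in> J" "ge (y, {z \<in> x ` I. P z}) q" for q
      using that by (auto simp: J_def ge_def)
    ultimately show "eventually P (filtermap fst (net_filter J ge))"
      unfolding eventually_filtermap eventually_net_filter[OF dJ] by blast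
  qed
  have "bounded_weakly_null_net J ge fst"
    unfolding bounded_weakly_null_net_def
  proof (intro conjI)
    show "directed_set J ge" by (rule dJ)
    show "bounded (fst ` J)" by (rule bounded_subset[OF bd]) (auto simp: J_def)
    have "\<forall>\<^sub>F i in net_filter J ge. fst i \<in> U"
      if "openin weak_topology U" "0 \<in> U" for U
    proof -
      have "eventually (\<lambda>z. z \<in> U) F"
        using lim that by (simp add: F_def eventually_filtermap limitin_def)
      then show ?thesis by (simp flip: F_eq add: eventually_filtermap)
    qed
    then show "limitin weak_topology fst 0 (net_filter J ge)"
      by (simp add: limitin_def)
  qed
  with M uv have "Limsup (net_filter J ge) (\<lambda>i. ereal (norm (r *\<^sub>R u + s *\<^sub>R fst i)))
      \<le> Limsup (net_filter J ge) (\<lambda>i. ereal (norm (v + fst i)))"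
    unfolding property_M_def by blast
  then have "Limsup F (\<lambda>y. ereal (norm (r *\<^sub>R u + s *\<^sub>R y))) \<le> Limsup F (\<lambda>y. ereal (norm (v + y)))"
    by (simp flip: F_eq add: Limsup_filtermap_image)
  then show ?thesis by (simp add: F_def Limsup_filtermap_image)
qed

end

theory Submission
  imports Defs
begin

text \<open>
  Suppose a weakly null sequence \<open>x\<close> with \<open>norm (x n) \<longlonglongrightarrow> 1\<close> had \<open>asymptotic_sep x \<le> 1\<close>. Property
  \<open>M(1, s)\<close> lets the term \<open>x n\<close> in \<open>norm (x n - x m)\<close> be traded for any vector of the same norm, at
  the price of scaling \<open>x m\<close> by \<open>s\<close>; since \<open>norm (x n)\<close> tends to \<open>1\<close>, this yields
  \<open>limsup (\<lambda>m. norm (u - s *\<^sub>R x m)) \<le> 1\<close> for \<^emph>\<open>every\<close> unit vector \<open>u\<close>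
  (\<open>property_M_perturbed_unit_vector\<close>).

  Both \<open>u = x0\<close> and \<open>u = - x0\<close> are useful. The vectors \<open>x0 - s *\<^sub>R x m\<close> and \<open>- x0 - s *\<^sub>R x m\<close>
  differ by \<open>2 *\<^sub>R x0\<close>, so their norms add up to at least \<open>2\<close>; as neither is asymptotically above
  \<open>1\<close>, both tend to \<open>1\<close>.

  So \<open>x0 - s *\<^sub>R x m\<close> converges weakly to \<open>x0\<close> and its norm converges to \<open>norm x0\<close>. Where the weak
  and norm topologies of the sphere agree, this forces norm convergence
  (\<open>weak_norm_agree_at_tendsto\<close>), whence \<open>s *\<^sub>R x m\<close> tends to \<open>0\<close> in norm, which is impossible for
  \<open>s > 0\<close> and \<open>norm (x m) \<longlonglongrightarrow> 1\<close>.
\<close>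

lemma directed_set_nat: "directed_set (UNIV :: nat set) (\<le>)"
  unfolding directed_set_def by (auto intro: max.cobounded1 max.cobounded2)

lemma net_filter_nat: "net_filter (UNIV :: nat set) (\<le>) = sequentially"
  by (simp add: filter_eq_iff eventually_net_filter[OF directed_set_nat] eventually_sequentially)

lemma property_M_sequence:
  fixes x :: "nat \<Rightarrow> 'a::real_normed_vector"
  assumes "property_M TYPE('a) r s" and "norm u \<le> norm v"
    and "bounded (range x)" and "limitin weak_topology x 0 sequentially"
  shows "limsup (\<lambda>m. ereal (norm (r *\<^sub>R u + s *\<^sub>R x m))) \<le> limsup (\<lambda>m. ereal (norm (v + x m)))"
  using property_M_any_net[OF assms(1,2), of UNIV "(\<le>)" x] assms(3,4)
  by (simp add: bounded_weakly_null_net_def directed_set_nat net_filter_nat)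

text \<open>Since \<open>norm (x n) *\<^sub>R u\<close> has the norm of \<open>x n\<close>, property \<open>M(1, s)\<close> bounds
  \<open>norm (norm (x n) *\<^sub>R u - s *\<^sub>R x m)\<close> asymptotically in \<open>m\<close> by \<open>norm (x n - x m)\<close>, and for large
  \<open>n\<close> the factor \<open>norm (x n)\<close> is negligible.\<close>

lemma property_M_perturbed_unit_vector:
  fixes x :: "nat \<Rightarrow> 'a::real_normed_vector"
  assumes M: "property_M TYPE('a) 1 s"
    and weak: "limitin weak_topology x 0 sequentially"
    and norm: "(\<lambda>n. norm (x n)) \<longlonglongrightarrow> 1"
    and sep: "asymptotic_sep x \<le> ereal c"
    and u: "norm u = 1" and e: "e > 0"
  shows "\<forall>\<^sub>F m in sequentially. norm (u - s *\<^sub>R x m) < c + e"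
proof -
  have "asymptotic_sep x < ereal (c + e / 2)"
    using sep e by (simp add: le_less_trans)
  then have "\<forall>\<^sub>F n in sequentially. limsup (\<lambda>m. ereal (norm (x n - x m))) < ereal (c + e / 2)"
    unfolding asymptotic_sep_def by (rule Limsup_lessD)
  moreover have "\<forall>\<^sub>F n in sequentially. dist (norm (x n)) 1 < e / 2"
    using norm e by (intro tendstoD) auto
  ultimately have "\<forall>\<^sub>F n in sequentially. limsup (\<lambda>m. ereal (norm (x n - x m))) < ereal (c + e / 2)
      \<and> dist (norm (x n)) 1 < e / 2"
    by (rule eventually_conj)
  then obtain n where n: "limsup (\<lambda>m. ereal (norm (x n - x m))) < ereal (c + e / 2)"
      "\<bar>norm (x n) - 1\<bar> < e / 2"
    using eventually_happens'[OF sequentially_bot] by (force simp: dist_real_def)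
  have "bounded (range x)"
    using norm Bseq_eq_bounded[of x] convergent_imp_Bseq[of "\<lambda>n. norm (x n)"]
    by (auto simp: convergent_def Bseq_def)
  then have "bounded (range (\<lambda>m. - x m))"
    by (simp add: bounded_iff)
  moreover have "limitin weak_topology (\<lambda>m. - x m) 0 sequentially"
    using weak unfolding limitin_weak_topology
    by (auto simp: blinfun.minus_right blinfun.zero_right intro: tendsto_eq_intros)
  ultimately have "limsup (\<lambda>m. ereal (norm (1 *\<^sub>R (norm (x n) *\<^sub>R u) + s *\<^sub>R (- x m))))
      \<le> limsup (\<lambda>m. ereal (norm (x n + (- x m))))"
    using u by (intro property_M_sequence[OF M]) auto
  with n have "limsup (\<lambda>m. ereal (norm (norm (x n) *\<^sub>R u - s *\<^sub>R x m))) < ereal (c + e / 2)"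
    by simp
  then have "\<forall>\<^sub>F m in sequentially. norm (norm (x n) *\<^sub>R u - s *\<^sub>R x m) < c + e / 2"
    by (auto dest: Limsup_lessD)
  then show ?thesis
  proof eventually_elim
    case (elim m)
    have split: "(1 - norm (x n)) *\<^sub>R u + (norm (x n) *\<^sub>R u - s *\<^sub>R x m) = u - s *\<^sub>R x m"
      by (simp add: algebra_simps)
    have "norm (u - s *\<^sub>R x m) \<le> \<bar>1 - norm (x n)\<bar> + norm (norm (x n) *\<^sub>R u - s *\<^sub>R x m)"
      using norm_triangle_ineq[of "(1 - norm (x n)) *\<^sub>R u" "norm (x n) *\<^sub>R u - s *\<^sub>R x m"] u
      unfolding split by simp
    with elim n(2) show ?case by linarith
  qed
qed

text \<open>Agreement of the topologies concerns points of the sphere only, so it is applied to the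
  normalised vectors \<open>sgn (y i)\<close>; as \<open>norm (y i)\<close> tends to \<open>1\<close>, normalising affects neither the weak
  nor the norm limit.\<close>

lemma weak_norm_agree_at_tendsto:
  fixes y :: "'i \<Rightarrow> 'a::real_normed_vector"
  assumes agree: "weak_norm_agree_at x0"
    and weak: "limitin weak_topology y x0 F"
    and norm: "((\<lambda>i. norm (y i)) \<longlongrightarrow> 1) F"
  shows "(y \<longlongrightarrow> x0) F"
proof -
  have x0: "x0 \<in> sphere 0 1"
    using agree by (simp add: weak_norm_agree_at_def topcontinuous_at_def)
  have "((\<lambda>i. f (sgn (y i))) \<longlongrightarrow> f x0) F" for f :: "'a \<Rightarrow>\<^sub>L real"
  proof -
    have "((\<lambda>i. f (y i)) \<longlongrightarrow> f x0) F"
      using weak by (simp add: limitin_weak_topology)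
    then have "((\<lambda>i. inverse (norm (y i)) * f (y i)) \<longlongrightarrow> inverse 1 * f x0) F"
      by (intro tendsto_mult tendsto_inverse norm) simp_all
    then show ?thesis
      by (simp add: sgn_div_norm blinfun.scaleR_right)
  qed
  then have weak_sgn: "limitin weak_topology (\<lambda>i. sgn (y i)) x0 F"
    by (simp add: limitin_weak_topology)
  have "\<forall>\<^sub>F i in F. 0 < norm (y i)"
    using norm by (rule order_tendstoD) simp
  then have sphere: "\<forall>\<^sub>F i in F. sgn (y i) \<in> sphere 0 1"
    by eventually_elim (simp add: norm_sgn)
  have "((\<lambda>i. sgn (y i)) \<longlongrightarrow> x0) F"
  proof (rule topological_tendstoI)
    fix V :: "'a set" assume V: "open V" "x0 \<in> V"
    then have "openin (top_of_set (sphere 0 1)) (sphere 0 1 \<inter> V)" "id x0 \<in> sphere 0 1 \<inter> V"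
      using x0 by (auto intro: openin_open_Int)
    then obtain U where U: "openin (subtopology weak_topology (sphere 0 1)) U" "x0 \<in> U"
        "\<forall>z\<in>U. id z \<in> sphere 0 1 \<inter> V"
      using agree unfolding weak_norm_agree_at_def topcontinuous_at_def by meson
    then obtain W where W: "openin weak_topology W" "U = W \<inter> sphere 0 1"
      by (auto simp: openin_subtopology)
    then have "\<forall>\<^sub>F i in F. sgn (y i) \<in> W"
      using weak_sgn U(2) by (simp add: limitin_def)
    with sphere show "\<forall>\<^sub>F i in F. sgn (y i) \<in> V"
      by eventually_elim (use U(3) W(2) in auto)
  qed
  with norm have "((\<lambda>i. norm (y i) *\<^sub>R sgn (y i)) \<longlongrightarrow> 1 *\<^sub>R x0) F"
    by (rule tendsto_scaleR)
  moreover have "norm (y i) *\<^sub>R sgn (y i) = y i" for i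
    by (cases "y i = 0") (simp_all add: sgn_div_norm)
  ultimately show ?thesis
    by simp
qed

theorem proposition3p1:
  fixes s :: real and x0 :: "'a::banach"
  assumes "0 < s" "s \<le> 1"
    and "property_M TYPE('a) 1 s"
    and "x0 \<in> sphere 0 1"
    and "weak_norm_agree_at x0"
  shows "GGLD TYPE('a)"
  unfolding GGLD_def
proof (intro allI impI, rule ccontr)
  fix x :: "nat \<Rightarrow> 'a"
  assume weak: "limitin weak_topology x 0 sequentially"
    and norm: "(\<lambda>n. norm (x n)) \<longlonglongrightarrow> 1"
    and "\<not> asymptotic_sep x > 1"
  then have sep: "asymptotic_sep x \<le> ereal 1"
    by (simp add: one_ereal_def)
  have x0: "norm x0 = 1"
    using assms(4) by simp
  have "(\<lambda>m. norm (x0 - s *\<^sub>R x m)) \<longlonglongrightarrow> 1"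
  proof (rule tendstoI)
    fix e :: real assume e: "e > 0"
    have "\<forall>\<^sub>F m in sequentially. norm (x0 - s *\<^sub>R x m) < 1 + e"
      using property_M_perturbed_unit_vector[OF assms(3) weak norm sep x0 e] .
    moreover have "\<forall>\<^sub>F m in sequentially. norm (- x0 - s *\<^sub>R x m) < 1 + e"
      using property_M_perturbed_unit_vector[OF assms(3) weak norm sep _ e, of "- x0"] x0 by simp
    ultimately show "\<forall>\<^sub>F m in sequentially. dist (norm (x0 - s *\<^sub>R x m)) 1 < e"
    proof eventually_elim
      case (elim m)
      have "(x0 - s *\<^sub>R x m) - (- x0 - s *\<^sub>R x m) = 2 *\<^sub>R x0"
        by (simp add: scaleR_2)
      then have "2 \<le> norm (x0 - s *\<^sub>R x m) + norm (- x0 - s *\<^sub>R x m)"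
        using norm_triangle_ineq4[of "x0 - s *\<^sub>R x m" "- x0 - s *\<^sub>R x m"] x0 by simp
      with elim show ?case by (simp add: dist_real_def abs_less_iff)
    qed
  qed
  moreover have "limitin weak_topology (\<lambda>m. x0 - s *\<^sub>R x m) x0 sequentially"
    unfolding limitin_weak_topology
  proof
    fix f :: "'a \<Rightarrow>\<^sub>L real"
    have "(\<lambda>m. f (x m)) \<longlonglongrightarrow> 0"
      using weak by (simp add: limitin_weak_topology blinfun.zero_right)
    then have "(\<lambda>m. f x0 - s * f (x m)) \<longlonglongrightarrow> f x0 - s * 0"
      by (intro tendsto_intros)
    then show "(\<lambda>m. f (x0 - s *\<^sub>R x m)) \<longlonglongrightarrow> f x0"
      by (simp add: blinfun.diff_right blinfun.scaleR_right)
  qed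
  ultimately have "(\<lambda>m. x0 - s *\<^sub>R x m) \<longlonglongrightarrow> x0"
    using weak_norm_agree_at_tendsto[OF assms(5)] by blast
  then have "(\<lambda>m. norm (x0 - (x0 - s *\<^sub>R x m))) \<longlonglongrightarrow> norm (x0 - x0)"
    by (intro tendsto_intros)
  then have "(\<lambda>m. s * norm (x m)) \<longlonglongrightarrow> 0"
    using assms(1) by simp
  moreover have "(\<lambda>m. s * norm (x m)) \<longlonglongrightarrow> s * 1"
    using norm by (intro tendsto_intros)
  ultimately show False
    using LIMSEQ_unique assms(1) by fastforce
qed

end
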